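(* The distribution of the fractional linear birth process with a single initial progenitor has the form $$p_k^\nu(t)=\Pr\{N_\nu(t)=k\mid N_\nu(0)=1\}=\sum_{j=1}^{k}\binom{k-1}{j-1}(-1)^{j-1}E_{\nu,1}(-\lambda j t^\nu),\qquad k\ge1,\ 0<\nu\le1,$$ where $E_{\nu,1}(x)$ is the Mittag-Leffler function.
   Context: Here $t>0$, and $N_\nu(t)$ denotes the number of individuals at time $t$ in the fractional linear birth process, that is, the fractional birth process with birth rates $\lambda_k=\lambda k$, $\lambda>0$, $k\ge1$. Its state probabilities $p_k(t)=\Pr\{N_\nu(t)=k\mid N_\nu(0)=1\}$ (written $p_k^\nu(t)$ for the solutions) satisfy the difference-differential equations $$\frac{\mathrm{d}^\nu p_k}{\mathrm{d}t^\nu}=-\lambda k\,p_k+\lambda(k-1)\,p_{k-1},\qquad k\ge1,\ 0<\nu\le1,$$ with $p_1(0)=1$ and $p_k(0)=0$ for $k\ge2$ (for $k=1$ the last term of the equation vanishes). The fractional derivative is understood in the Dzherbashyan--Caputo sense, that is, for $0<\nu<1$, $$\frac{\mathrm{d}^\nu p_k}{\mathrm{d}t^\nu}(t)=\frac{1}{\Gamma(1-\nu)}\int_0^t\frac{\frac{\mathrm{d}}{\mathrm{d}s}p_k(s)}{(t-s)^\nu}\,\mathrm{d}s,$$ and for $\nu=1$ it is the ordinary first derivative. The Mittag-Leffler function is $E_{\nu,1}(x)=\sum_{h=0}^\infty\frac{x^h}{\Gamma(\nu h+1)}$, $x\in\mathbb R$, $\nu>0$. *)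

theory Defs
  imports "HOL-Probability.Probability"
begin

definition mittag_leffler :: "real \<Rightarrow> real \<Rightarrow> real"  (* E_{nu,1} *)
  where "mittag_leffler nu x = (\<Sum>h. x ^ h / Gamma (nu * real h + 1))"

text \<open>
  The Dzherbashyan--Caputo derivative of order \<open>nu\<close> in \<open>(0, 1]\<close> with base point 0, as a relation
  \<open>f has the derivative D at t\<close>, so that existence of the inner derivative and absolute convergence
  of the singular integral are part of the assertion. Only values of \<open>f\<close> at positive arguments
  enter.
\<close>
definition has_caputo_derivative :: "(real \<Rightarrow> real) \<Rightarrow> real \<Rightarrow> real \<Rightarrow> real \<Rightarrow> bool"
  where "has_caputo_derivative f D nu t \<longleftrightarrow>
    (if nu = 1 then (f has_real_derivative D) (at t)
     else (\<forall>s\<in>{0<..<t}. f differentiable (at s)) \<and>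
          set_integrable lborel {0<..<t} (\<lambda>s. deriv f s / (t - s) powr nu) \<and>
          D = 1 / Gamma (1 - nu) * (LINT s:{0<..<t}|lborel. deriv f s / (t - s) powr nu))"

definition state_prob :: "'a measure \<Rightarrow> (real \<Rightarrow> 'a \<Rightarrow> nat) \<Rightarrow> nat \<Rightarrow> real \<Rightarrow> real"
  where "state_prob M N k t = \<P>(\<omega> in M. N t \<omega> = k \<bar> N 0 \<omega> = 1)"

text \<open>
  The process enters only through its state probabilities. Since \<open>\<P>(A \<bar> B) = 0\<close> when \<open>B\<close> is a null
  set, \<open>init_one\<close> also forces the conditioning event to have positive probability. Right-continuity
  at 0 ties the initial values to the equations, which see the state probabilities only at positive
  times; without it the initial value problem does not determine them.
\<close>
locale fractional_birth_process = prob_space M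
  for M :: "'a measure" and N :: "real \<Rightarrow> 'a \<Rightarrow> nat"
    and rate :: "nat \<Rightarrow> real" and nu :: real +
  assumes random_var: "\<And>t. t \<ge> 0 \<Longrightarrow> random_variable (count_space UNIV) (N t)"
    and init_one: "state_prob M N 1 0 = 1"
    and init_other: "\<And>k. k \<ge> 2 \<Longrightarrow> state_prob M N k 0 = 0"
    and cont_at_0: "\<And>k. k \<ge> 1 \<Longrightarrow> continuous (at_right 0) (state_prob M N k)"
    and state_eq: "\<And>k t. k \<ge> 1 \<Longrightarrow> t > 0 \<Longrightarrow>
      has_caputo_derivative (state_prob M N k)
        (- rate k * state_prob M N k t
          + (if k = 1 then 0 else rate (k - 1) * state_prob M N (k - 1) t)) nu t"

end

theory Submission
  imports Defs
begin

text \<open>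
  The Riemann--Liouville integral \<open>J\<close> of order \<open>nu\<close> turns each state equation into an integral
  equation. Since \<open>J\<close> composed with the Caputo derivative of order \<open>nu\<close> is the ordinary integral of
  the first derivative, the state probabilities satisfy, for \<open>k \<ge> 1\<close>,
  \<open>p\<^sub>k = p\<^sub>k(0) + J(- lam k p\<^sub>k + lam (k - 1) p\<^sub>k\<^sub>-\<^sub>1)\<close>. This is \<open>frac_integral_caputo\<close>; it rests on
  Fubini's theorem and on the Beta integral, by which the two singular kernels
  \<open>(t - r)\<close> to the power \<open>nu - 1\<close> and \<open>(r - s)\<close> to the power \<open>- nu\<close> convolve to a constant.

  The claimed sums satisfy the same integral equations. For a single exponent, \<open>J\<close> maps powers to
  powers, so that integrating the Mittag-Leffler series term by term shifts it by one index and gives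
  \<open>e = 1 + c J e\<close> for \<open>e(t) = E(c t\<^sup>n\<^sup>u)\<close> (\<open>mittag_leffler_Volterra\<close>). The binomial coefficients
  combine these equations for \<open>c = - lam j\<close> in the right way: their alternating sum produces the
  initial values, and the identity \<open>(k - j) (k-1 choose j-1) = (k - 1) (k-2 choose j-1)\<close> produces the
  coupling between \<open>k\<close> and \<open>k - 1\<close> (\<open>yule_sum_Volterra\<close>).

  Finally the integral equations have only one continuous solution. By induction on \<open>k\<close>, the
  difference \<open>u\<close> of two solutions satisfies \<open>u = - lam k J u\<close>. Iterating this \<open>n\<close> times bounds
  \<open>\<bar>u\<bar>\<close> by a constant times the \<open>n\<close>-th term of a Mittag-Leffler series, which tends to 0
  (\<open>Volterra_eq_0\<close>).
\<close>

section \<open>The Riemann--Liouville integral\<close>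

lemma Gamma_real_nonzero [simp]: "x > 0 \<Longrightarrow> Gamma x \<noteq> (0::real)"
  by (auto simp: Gamma_eq_zero_iff elim!: nonpos_Ints_cases')

definition frac_integral :: "real \<Rightarrow> (real \<Rightarrow> real) \<Rightarrow> real \<Rightarrow> real"
  where "frac_integral nu f t =
    (LINT s:{0<..<t}|lborel. (t - s) powr (nu - 1) * f s) / Gamma nu"

text \<open>
  An affine substitution carries \<open>{s<..<t}\<close> to the unit interval, where this is Euler's Beta integral.
  It serves both for the integral of a power and for the composition of two singular kernels.
\<close>
lemma Beta_integral_interval:
  fixes a b s t :: real
  assumes "a > 0" "b > 0" "s < t"
  shows "set_integrable lborel {s<..<t} (\<lambda>r. (r - s) powr (a - 1) * (t - r) powr (b - 1))"
    and "(LINT r:{s<..<t}|lborel. (r - s) powr (a - 1) * (t - r) powr (b - 1)) =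
      Beta a b * (t - s) powr (a + b - 1)"
proof -
  define g where "g x = indicator {0<..<1::real} x * (x powr (a - 1) * (1 - x) powr (b - 1))" for x
  have i: "set_integrable lborel {0<..<1} (\<lambda>x. x powr (a - 1) * (1 - x) powr (b - 1))"
    by (rule set_integrable_subset[OF integrable_Beta]) (use assms in auto)
  have "integral {0<..<1} (\<lambda>x. x powr (a - 1) * (1 - x) powr (b - 1)) = Beta a b"
    using has_integral_Beta_real[of a b] assms
    by (intro integral_unique) (simp add: has_integral_Icc_iff_Ioo)
  then have g: "has_bochner_integral lborel g (Beta a b)"
    using i set_borel_integral_eq_integral(2)[OF i]
    unfolding has_bochner_integral_iff set_integrable_def set_lebesgue_integral_def g_def by simp
  \<comment> \<open>The two kernel factors scale with exponents \<open>a - 1\<close> and \<open>b - 1\<close>, which add up to \<open>a + b - 2\<close>;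
    the Jacobian contributes the remaining factor \<open>t - s\<close>.\<close>
  define h where "h x = (t - s) powr (a + b - 2) * g (x / (t - s) - s / (t - s))" for x
  have "has_bochner_integral lborel (\<lambda>x. g (- s / (t - s) + (1 / (t - s)) * x)) (Beta a b * (t - s))"
    using g assms(3) lborel_has_bochner_integral_real_affine_iff
      [of "1 / (t - s)" g "Beta a b" "- s / (t - s)"]
    by (simp add: mult.commute)
  then have "has_bochner_integral lborel h ((t - s) powr (a + b - 2) * (Beta a b * (t - s)))"
    unfolding h_def by (intro has_bochner_integral_mult_right) (simp add: algebra_simps)
  moreover have "(t - s) powr (a + b - 2) * (Beta a b * (t - s)) = Beta a b * (t - s) powr (a + b - 1)"
    using assms(3) powr_add[of "t - s" "a + b - 2" 1] by simp
  moreover have "h = (\<lambda>r. indicator {s<..<t} r *\<^sub>R ((r - s) powr (a - 1) * (t - r) powr (b - 1)))"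
  proof
    fix r
    have "(t - s) powr (a + b - 2) * (((r - s) / (t - s)) powr (a - 1) * ((t - r) / (t - s)) powr (b - 1))
        = (r - s) powr (a - 1) * (t - r) powr (b - 1)" if "s < r" "r < t"
      using that powr_add[of "t - s" "a - 1" "b - 1"]
      by (simp add: powr_divide algebra_simps)
    moreover have "r / (t - s) - s / (t - s) = (r - s) / (t - s)"
      by (simp add: diff_divide_distrib)
    moreover have "1 - (r - s) / (t - s) = (t - r) / (t - s)"
      using assms(3) by (simp add: diff_divide_eq_iff)
    moreover have "(r - s) / (t - s) \<in> {0<..<1} \<longleftrightarrow> r \<in> {s<..<t}"
      using assms(3) by (auto simp: zero_less_divide_iff)
    ultimately show "h r = indicator {s<..<t} r *\<^sub>R ((r - s) powr (a - 1) * (t - r) powr (b - 1))"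
      unfolding h_def g_def by (simp add: indicator_def)
  qed
  ultimately show "set_integrable lborel {s<..<t} (\<lambda>r. (r - s) powr (a - 1) * (t - r) powr (b - 1))"
    "(LINT r:{s<..<t}|lborel. (r - s) powr (a - 1) * (t - r) powr (b - 1)) =
      Beta a b * (t - s) powr (a + b - 1)"
    unfolding has_bochner_integral_iff set_integrable_def set_lebesgue_integral_def by simp_all
qed

lemma
  fixes a nu t :: real
  assumes "a \<ge> 0" "nu > 0" "t > 0"
  shows integrable_kernel_powr:
      "set_integrable lborel {0<..<t} (\<lambda>s. (t - s) powr (nu - 1) * s powr a)"
    and frac_integral_powr:
      "frac_integral nu (\<lambda>s. s powr a) t = Gamma (a + 1) / Gamma (a + nu + 1) * t powr (a + nu)"
proof -
  show "set_integrable lborel {0<..<t} (\<lambda>s. (t - s) powr (nu - 1) * s powr a)"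
    using Beta_integral_interval(1)[of "a + 1" nu 0 t] assms by (simp add: mult.commute)
  have "(LINT s:{0<..<t}|lborel. (t - s) powr (nu - 1) * s powr a) = Beta (a + 1) nu * t powr (a + nu)"
    using Beta_integral_interval(2)[of "a + 1" nu 0 t] assms by (simp add: mult.commute)
  then show "frac_integral nu (\<lambda>s. s powr a) t = Gamma (a + 1) / Gamma (a + nu + 1) * t powr (a + nu)"
    using Gamma_real_pos[of nu] assms(2) by (simp add: frac_integral_def Beta_def add_ac)
qed

lemma integrable_kernel_continuous:
  fixes f :: "real \<Rightarrow> real"
  assumes "nu > 0" "t > 0" "continuous_on {0..t} f"
  shows "set_integrable lborel {0<..<t} (\<lambda>s. (t - s) powr (nu - 1) * f s)"
proof -
  have "compact (f ` {0..t})" using assms(3) by (intro compact_continuous_image) auto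
  then obtain C where C: "\<forall>s\<in>{0..t}. \<bar>f s\<bar> \<le> C"
    by (auto dest!: compact_imp_bounded simp: bounded_iff)
  have "set_integrable lborel {0<..<t} (\<lambda>s. C * (t - s) powr (nu - 1))"
    proof (rule set_integrable_mult_right)
    have "set_integrable lborel {0<..<t} (\<lambda>s. (t - s) powr (nu - 1)) \<longleftrightarrow>
        set_integrable lborel {0<..<t} (\<lambda>s. (t - s) powr (nu - 1) * s powr 0)"
      by (rule set_integrable_cong) auto
    then show "set_integrable lborel {0<..<t} (\<lambda>s. (t - s) powr (nu - 1))"
      using integrable_kernel_powr[of 0 nu t] assms(1,2) by simp
  qed
  moreover have "continuous_on {0<..<t} (\<lambda>s. (t - s) powr (nu - 1) * f s)"
    by (intro continuous_intros continuous_on_subset[OF assms(3)]) auto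
  then have "set_borel_measurable lborel {0<..<t} (\<lambda>s. (t - s) powr (nu - 1) * f s)"
    using set_measurable_continuous_on[of "{0<..<t}" "\<lambda>s. (t - s) powr (nu - 1) * f s"]
    unfolding set_borel_measurable_def by simp
  ultimately show ?thesis
    by (rule set_integrable_bound)
      (use C in \<open>auto intro!: AE_I2 simp: abs_mult mult.commute intro: mult_right_mono order_trans[OF _ abs_ge_self]\<close>)
qed

text \<open>
  One step of the iteration behind uniqueness: each application of the integral raises the exponent of
  a power bound by \<open>nu\<close> and gains a quotient of Gamma values, and these quotients telescope.
\<close>
lemma abs_frac_integral_le:
  fixes f :: "real \<Rightarrow> real"
  assumes "nu > 0" "a \<ge> 0" "t > 0" "continuous_on {0..t} f"
    and le: "\<And>s. 0 < s \<Longrightarrow> s < t \<Longrightarrow> \<bar>f s\<bar> \<le> C * s powr a"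
  shows "\<bar>frac_integral nu f t\<bar> \<le> C * (Gamma (a + 1) / Gamma (a + nu + 1)) * t powr (a + nu)"
proof -
  have i: "set_integrable lborel {0<..<t} (\<lambda>s. (t - s) powr (nu - 1) * f s)"
    by (rule integrable_kernel_continuous) fact+
  have "\<bar>LINT s:{0<..<t}|lborel. (t - s) powr (nu - 1) * f s\<bar>
      \<le> (LINT s:{0<..<t}|lborel. \<bar>(t - s) powr (nu - 1) * f s\<bar>)"
    using integral_norm_bound[of lborel "\<lambda>s. indicator {0<..<t} s *\<^sub>R ((t - s) powr (nu - 1) * f s)"]
    by (simp add: set_lebesgue_integral_def abs_mult)
  also have "\<dots> \<le> (LINT s:{0<..<t}|lborel. C * ((t - s) powr (nu - 1) * s powr a))"
    using le by (intro set_integral_mono set_integrable_abs i set_integrable_mult_right integrable_kernel_powr assms)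
      (auto simp: abs_mult mult.left_commute[of C] intro!: mult_left_mono)
  finally have "\<bar>frac_integral nu f t\<bar> \<le> C * frac_integral nu (\<lambda>s. s powr a) t"
    using Gamma_real_pos[OF assms(1)] by (simp add: frac_integral_def abs_divide divide_right_mono)
  then show ?thesis using frac_integral_powr[of a nu t] assms by simp
qed

lemma frac_integral_add:
  fixes f g :: "real \<Rightarrow> real"
  assumes "nu > 0" "t > 0" "continuous_on {0..t} f" "continuous_on {0..t} g"
  shows "frac_integral nu (\<lambda>s. f s + g s) t = frac_integral nu f t + frac_integral nu g t"
  using integrable_kernel_continuous[OF assms(1,2,3)] integrable_kernel_continuous[OF assms(1,2,4)]
  by (simp add: frac_integral_def distrib_left add_divide_distrib)

lemma frac_integral_diff:
  fixes f g :: "real \<Rightarrow> real"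
  assumes "nu > 0" "t > 0" "continuous_on {0..t} f" "continuous_on {0..t} g"
  shows "frac_integral nu (\<lambda>s. f s - g s) t = frac_integral nu f t - frac_integral nu g t"
  using integrable_kernel_continuous[OF assms(1,2,3)] integrable_kernel_continuous[OF assms(1,2,4)]
  by (simp add: frac_integral_def right_diff_distrib diff_divide_distrib)

lemma frac_integral_cmult: "frac_integral nu (\<lambda>s. c * f s) t = c * frac_integral nu f t"
proof -
  have "(\<lambda>s. (t - s) powr (nu - 1) * (c * f s)) = (\<lambda>s. c * ((t - s) powr (nu - 1) * f s))"
    by (simp add: mult_ac)
  then show ?thesis unfolding frac_integral_def by simp
qed

lemma frac_integral_sum:
  fixes f :: "'i \<Rightarrow> real \<Rightarrow> real"
  assumes "nu > 0" "t > 0" "\<And>i. i \<in> I \<Longrightarrow> continuous_on {0..t} (f i)"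
  shows "frac_integral nu (\<lambda>s. \<Sum>i\<in>I. f i s) t = (\<Sum>i\<in>I. frac_integral nu (f i) t)"
proof (cases "finite I")
  case True
  then show ?thesis using assms(3)
  proof (induction I)
    case (insert i I)
    then show ?case
      using frac_integral_add[OF assms(1,2), of "f i" "\<lambda>s. \<Sum>i\<in>I. f i s"]
      by (simp add: continuous_on_sum)
  qed (simp add: frac_integral_def)
qed (simp add: frac_integral_def)

lemma frac_integral_cong:
  "(\<And>s. 0 < s \<Longrightarrow> s < t \<Longrightarrow> f s = g s) \<Longrightarrow> frac_integral nu f t = frac_integral nu g t"
  unfolding frac_integral_def by (intro arg_cong2[where f = "(/)"] set_lebesgue_integral_cong) auto

section \<open>The Mittag-Leffler function\<close>

text \<open>
  The point \<open>a + 1\<close> lies between \<open>a + nu\<close> and \<open>a + nu + 1\<close>, so log-convexity bounds \<open>Gamma (a + 1)\<close> by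
  a weighted geometric mean of the values there; the recurrence \<open>Gamma (x + 1) = x Gamma x\<close> then leaves
  only \<open>Gamma a\<close> and \<open>Gamma (a + nu)\<close>. Consecutive coefficients of the Mittag-Leffler series have
  this ratio, and the bound makes it vanish at infinity without Stirling's formula.
\<close>
lemma Gamma_ratio_le:
  fixes a nu :: real
  assumes "a > 0" "0 < nu" "nu \<le> 1"
  shows "Gamma a / Gamma (a + nu) \<le> (a + nu) powr (1 - nu) / a"
proof -
  have p: "Gamma a > 0" "Gamma (a + nu) > 0" using assms by (auto intro!: Gamma_real_pos)
  have "(ln \<circ> Gamma) ((1 - (1 - nu)) *\<^sub>R (a + nu) + (1 - nu) *\<^sub>R (a + nu + 1))
      \<le> (1 - (1 - nu)) * (ln \<circ> Gamma) (a + nu) + (1 - nu) * (ln \<circ> Gamma) (a + nu + 1)"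
    by (rule convex_onD[OF log_convex_Gamma_real]) (use assms in auto)
  moreover have "Gamma (a + 1) = a * Gamma a"
    using assms by (intro Gamma_plus1) (auto elim!: nonpos_Ints_cases')
  moreover have "Gamma (a + nu + 1) = (a + nu) * Gamma (a + nu)"
    using assms by (intro Gamma_plus1) (auto elim!: nonpos_Ints_cases')
  moreover have "(1 - (1 - nu)) *\<^sub>R (a + nu) + (1 - nu) *\<^sub>R (a + nu + 1) = a + 1"
    by (simp add: algebra_simps)
  moreover have "ln ((a + nu) * Gamma (a + nu)) = ln (a + nu) + ln (Gamma (a + nu))"
    "ln ((a + nu) powr (1 - nu) * Gamma (a + nu)) = (1 - nu) * ln (a + nu) + ln (Gamma (a + nu))"
    using assms p by (simp_all add: ln_mult ln_powr)
  ultimately have "ln (a * Gamma a) \<le> ln ((a + nu) powr (1 - nu) * Gamma (a + nu))"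
    by (simp add: algebra_simps)
  then have "a * Gamma a \<le> (a + nu) powr (1 - nu) * Gamma (a + nu)"
    using assms p by (subst (asm) ln_le_cancel_iff) auto
  then show ?thesis using assms p by (simp add: field_simps)
qed

lemma tendsto_Gamma_ratio:
  fixes nu :: real
  assumes "0 < nu" "nu \<le> 1"
  shows "((\<lambda>a. Gamma a / Gamma (a + nu)) \<longlongrightarrow> 0) at_top"
proof (rule tendsto_sandwich[of "\<lambda>_. 0" _ _ "\<lambda>a. (a + nu) powr (1 - nu) / a"])
  show "((\<lambda>a. (a + nu) powr (1 - nu) / a) \<longlongrightarrow> 0) at_top"
    using assms by real_asymp
  show "\<forall>\<^sub>F a in at_top. 0 \<le> Gamma a / Gamma (a + nu)"
    using eventually_gt_at_top[of 0] 
    by eventually_elim (use assms in \<open>auto intro!: divide_nonneg_nonneg less_imp_le Gamma_real_pos\<close>)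
  show "\<forall>\<^sub>F a in at_top. Gamma a / Gamma (a + nu) \<le> (a + nu) powr (1 - nu) / a"
    using eventually_gt_at_top[of 0] by eventually_elim (rule Gamma_ratio_le[OF _ assms])
qed auto

lemma summable_mittag_leffler:
  fixes nu x :: real
  assumes "0 < nu" "nu \<le> 1"
  shows "summable (\<lambda>h. x ^ h / Gamma (nu * real h + 1))"
proof -
  have pos: "Gamma (nu * real h + 1) > 0" for h
    using assms by (intro Gamma_real_pos) (simp add: add_nonneg_pos)
  have "filterlim (\<lambda>h. nu * real h + 1) at_top sequentially"
    using assms by real_asymp
  from filterlim_compose[OF tendsto_Gamma_ratio[OF assms] this]
  have "(\<lambda>h. \<bar>x\<bar> * (Gamma (nu * real h + 1) / Gamma (nu * real h + 1 + nu))) \<longlonglongrightarrow> \<bar>x\<bar> * 0"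
    by (intro tendsto_intros)
  then have "\<forall>\<^sub>F h in sequentially. \<bar>x\<bar> * (Gamma (nu * real h + 1) / Gamma (nu * real h + 1 + nu)) < 1/2"
    by (rule order_tendstoD) auto
  then obtain K where K: "\<And>h. h \<ge> K \<Longrightarrow>
      \<bar>x\<bar> * (Gamma (nu * real h + 1) / Gamma (nu * real h + 1 + nu)) < 1/2"
    by (auto simp: eventually_sequentially)
  show ?thesis
  proof (rule summable_ratio_test[of "1 / 2" K])
    fix h assume "h \<ge> K"
    have e: "nu * real (Suc h) + 1 = nu * real h + 1 + nu" by (simp add: algebra_simps)
    have "norm (x ^ Suc h / Gamma (nu * real (Suc h) + 1)) =
        (\<bar>x\<bar> * (Gamma (nu * real h + 1) / Gamma (nu * real h + 1 + nu))) * norm (x ^ h / Gamma (nu * real h + 1))"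
      using pos[of h] pos[of "Suc h"] unfolding e by (simp add: abs_mult power_abs)
    also have "\<dots> \<le> 1 / 2 * norm (x ^ h / Gamma (nu * real h + 1))"
      using K[OF \<open>h \<ge> K\<close>] by (intro mult_right_mono) auto
    finally show "norm (x ^ Suc h / Gamma (nu * real (Suc h) + 1))
      \<le> 1 / 2 * norm (x ^ h / Gamma (nu * real h + 1))" .
  qed simp
qed

lemma isCont_mittag_leffler:
  assumes "0 < nu" "nu \<le> 1"
  shows "isCont (mittag_leffler nu) x"
proof -
  have "isCont (\<lambda>x. \<Sum>h. 1 / Gamma (nu * real h + 1) * x ^ h) x"
    by (rule isCont_powser_converges_everywhere) (use summable_mittag_leffler[OF assms] in simp)
  then show ?thesis by (simp add: mittag_leffler_def[abs_def])
qed

lemma continuous_on_mittag_leffler_powr: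
  fixes c :: real
  assumes "0 < nu" "nu \<le> 1"
  shows "continuous_on {0..t} (\<lambda>s. mittag_leffler nu (c * s powr nu))"
proof (rule continuous_on_compose2[of UNIV "mittag_leffler nu"])
  show "continuous_on UNIV (mittag_leffler nu)"
    using isCont_mittag_leffler[OF assms] by (simp add: continuous_on_eq_continuous_at)
  show "continuous_on {0..t} (\<lambda>s. c * s powr nu)"
    using assms by (intro continuous_intros continuous_on_powr') auto
qed auto

text \<open>
  The integral of the term with exponent \<open>nu h\<close> is the term with exponent \<open>nu (h + 1)\<close> divided by \<open>c\<close>,
  so the integrated series is the original one without its leading term 1. Absolute convergence of the
  series, applied with \<open>\<bar>c\<bar>\<close>, justifies the termwise integration.
\<close>
lemma mittag_leffler_Volterra:
  fixes c :: real
  assumes nu: "0 < nu" "nu \<le> 1" and t: "t > 0"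
  shows "mittag_leffler nu (c * t powr nu) =
    1 + c * frac_integral nu (\<lambda>s. mittag_leffler nu (c * s powr nu)) t"
proof -
  define G where "G h = Gamma (nu * real h + 1)" for h
  have G: "G h > 0" for h
    unfolding G_def using assms by (intro Gamma_real_pos) (simp add: add_nonneg_pos)
  have pw: "(s powr nu) ^ h = s powr (nu * real h)" if "s > 0" for s h
    using that by (simp add: powr_powr flip: powr_realpow)
  \<comment> \<open>The parameter \<open>b\<close> takes the values \<open>c\<close> and \<open>\<bar>c\<bar>\<close>: the norm of a term for \<open>c\<close> is the term for
    \<open>\<bar>c\<bar>\<close>, so that one computation yields the integrals and their absolute summability.\<close>
  define u where "u b h s = indicator {0<..<t} s *\<^sub>R ((t - s) powr (nu - 1) * (b ^ h / G h * s powr (nu * real h)))"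
    for b h s
  have int_u: "integrable lborel (u b h)" for b h
    using set_integrable_mult_right[OF integrable_kernel_powr[of "nu * real h" nu t], of "b ^ h / G h"] assms
    by (simp add: set_integrable_def u_def[abs_def] mult_ac)
  have val_u: "integral\<^sup>L lborel (u b h) = Gamma nu * (b ^ h * (t powr nu) ^ Suc h / G (Suc h))" for b h
  proof -
    have "integral\<^sup>L lborel (u b h) = Gamma nu * frac_integral nu (\<lambda>s. b ^ h / G h * s powr (nu * real h)) t"
      using Gamma_real_pos[OF nu(1)] by (simp add: frac_integral_def u_def[abs_def] set_lebesgue_integral_def)
    also have "\<dots> = Gamma nu * (b ^ h / G h * (G h / G (Suc h) * t powr (nu * real (Suc h))))"
      using assms by (simp only: frac_integral_cmult, subst frac_integral_powr) (auto simp: G_def algebra_simps)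
    finally show ?thesis using G[of h] pw[OF t, of "Suc h"] by simp
  qed
  have u_power_series: "u b h s =
      indicator {0<..<t} s * (t - s) powr (nu - 1) * ((b * s powr nu) ^ h / G h)" for b h s
    by (auto simp: u_def indicator_def pw power_mult_distrib)
  have norm_u: "norm (u b h s) = u \<bar>b\<bar> h s" for b h s
    using G[of h] by (simp add: u_def abs_mult power_abs)
  have sm: "summable (\<lambda>h. y ^ h / G h)" for y
    using summable_mittag_leffler[OF nu] by (simp add: G_def)
  have "(\<lambda>h. integral\<^sup>L lborel (u c h)) sums (LINT s|lborel. (\<Sum>h. u c h s))"
  proof (rule sums_integral)
    show "AE s in lborel. summable (\<lambda>h. norm (u c h s))"
      unfolding norm_u unfolding u_power_series by (intro AE_I2 summable_mult sm)
    have "summable (\<lambda>h. \<bar>b\<bar> ^ h * (t powr nu) ^ Suc h / G (Suc h))" for b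
    proof (cases "b = 0")
      case True
      then show ?thesis by (intro summable_finite[of "{0}"]) auto
    next
      case False
      have "summable (\<lambda>h. 1 / \<bar>b\<bar> * ((\<bar>b\<bar> * t powr nu) ^ Suc h / G (Suc h)))"
        using sm by (intro summable_mult, subst summable_Suc_iff)
      then show ?thesis using False by (simp add: power_mult_distrib mult_ac)
    qed
    then show "summable (\<lambda>h. LINT s|lborel. norm (u c h s))"
      unfolding norm_u val_u by (intro summable_mult) simp
  qed (rule int_u)
  also have "(\<lambda>s. \<Sum>h. u c h s) =
      (\<lambda>s. indicator {0<..<t} s *\<^sub>R ((t - s) powr (nu - 1) * mittag_leffler nu (c * s powr nu)))"
    unfolding u_power_series suminf_mult[OF sm] unfolding mittag_leffler_def G_def
    by (simp add: mult.assoc)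
  finally have "(\<lambda>h. c / Gamma nu * integral\<^sup>L lborel (u c h)) sums
      (c * frac_integral nu (\<lambda>s. mittag_leffler nu (c * s powr nu)) t)"
    using sums_mult[where c = "c / Gamma nu"] by (fastforce simp: frac_integral_def set_lebesgue_integral_def)
  then have "(\<lambda>h. (c * t powr nu) ^ Suc h / G (Suc h)) sums
      (c * frac_integral nu (\<lambda>s. mittag_leffler nu (c * s powr nu)) t)"
    using Gamma_real_pos[OF nu(1)] by (simp add: val_u power_mult_distrib mult_ac)
  then have "(\<lambda>h. (c * t powr nu) ^ h / G h) sums
      (c * frac_integral nu (\<lambda>s. mittag_leffler nu (c * s powr nu)) t + 1)"
    by (subst (asm) sums_Suc_iff) (simp add: G_def)
  then show ?thesis by (simp add: mittag_leffler_def G_def sums_iff)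
qed

section \<open>Uniqueness for the Abel--Volterra equation\<close>

text \<open>
  A continuous \<open>u\<close> is bounded by some \<open>C\<close>, and feeding a bound back into the equation improves it: after
  \<open>n\<close> rounds it is \<open>C\<close> times the \<open>n\<close>-th term of a convergent Mittag-Leffler series.
\<close>
lemma Volterra_eq_0:
  fixes u :: "real \<Rightarrow> real"
  assumes nu: "0 < nu" "nu \<le> 1" and cont: "continuous_on {0..T} u"
    and eq: "\<And>t. 0 < t \<Longrightarrow> t \<le> T \<Longrightarrow> u t = c * frac_integral nu u t"
    and t: "0 < t" "t \<le> T"
  shows "u t = 0"
proof -
  have "compact (u ` {0..T})" using cont by (intro compact_continuous_image) auto
  then obtain C where C: "\<forall>s\<in>{0..T}. \<bar>u s\<bar> \<le> C"
    by (auto dest!: compact_imp_bounded simp: bounded_iff)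
  have bound: "\<bar>u t\<bar> \<le> C * \<bar>c\<bar> ^ n / Gamma (nu * real n + 1) * t powr (nu * real n)"
    if "0 < t" "t \<le> T" for n t
    using that
  proof (induction n arbitrary: t)
    case 0
    then show ?case using C by simp
  next
    case (Suc n)
    define G where "G h = Gamma (nu * real h + 1)" for h
    have G: "G h > 0" for h
      unfolding G_def using nu by (intro Gamma_real_pos) (simp add: add_nonneg_pos)
    have "\<bar>frac_integral nu u t\<bar> \<le> C * \<bar>c\<bar> ^ n / G n *
        (Gamma (nu * real n + 1) / Gamma (nu * real n + nu + 1)) * t powr (nu * real n + nu)"
      by (rule abs_frac_integral_le)
        (use Suc nu cont in \<open>auto simp: G_def intro: continuous_on_subset\<close>)
    also have "\<dots> = C * \<bar>c\<bar> ^ n / G (Suc n) * t powr (nu * real (Suc n))"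
      using G[of n] by (simp add: G_def algebra_simps)
    finally have "\<bar>c\<bar> * \<bar>frac_integral nu u t\<bar> \<le> \<bar>c\<bar> * (C * \<bar>c\<bar> ^ n / G (Suc n) * t powr (nu * real (Suc n)))"
      by (rule mult_left_mono) simp
    then show ?case using eq[OF Suc.prems] by (simp add: abs_mult G_def mult_ac)
  qed
  have "(\<lambda>n. C * ((\<bar>c\<bar> * t powr nu) ^ n / Gamma (nu * real n + 1))) \<longlonglongrightarrow> C * 0"
    by (intro tendsto_intros summable_LIMSEQ_zero summable_mittag_leffler nu)
  moreover have "(t powr nu) ^ n = t powr (nu * real n)" for n
    using t(1) by (simp add: powr_powr powr_realpow[of "t powr nu" n, symmetric])
  then have "C * ((\<bar>c\<bar> * t powr nu) ^ n / Gamma (nu * real n + 1)) =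
      C * \<bar>c\<bar> ^ n / Gamma (nu * real n + 1) * t powr (nu * real n)" for n
    by (simp add: power_mult_distrib)
  ultimately have "(\<lambda>n. C * \<bar>c\<bar> ^ n / Gamma (nu * real n + 1) * t powr (nu * real n)) \<longlonglongrightarrow> 0"
    by (simp only: mult_zero_right)
  then have "\<bar>u t\<bar> \<le> 0"
    by (rule LIMSEQ_le_const) (use bound[OF t] in blast)
  then show ?thesis by simp
qed

section \<open>Inverting the Caputo derivative\<close>

text \<open>
  At order 1 the kernel is constant and the claim is the fundamental theorem of calculus. The interior
  version of that theorem is used here and below because nothing is known about derivatives at 0.
\<close>
lemma frac_integral_caputo_1:
  fixes f g :: "real \<Rightarrow> real"
  assumes t: "0 < t" and f: "continuous_on {0..t} f" and g: "continuous_on {0..t} g"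
    and D: "\<And>s. 0 < s \<Longrightarrow> s < t \<Longrightarrow> (f has_real_derivative g s) (at s)"
  shows "frac_integral 1 g t = f t - f 0"
proof -
  have "(g has_integral (f t - f 0)) {0..t}"
    using t f D by (intro fundamental_theorem_of_calculus_interior)
      (auto simp flip: has_real_derivative_iff_has_vector_derivative)
  then have "((\<lambda>s. (t - s) powr (1 - 1) * g s) has_integral (f t - f 0)) {0<..<t}"
    by (subst has_integral_cong[where g = g]) (auto simp: has_integral_Icc_iff_Ioo)
  moreover have *: "set_integrable lborel {0<..<t} (\<lambda>s. (t - s) powr (1 - 1) * g s)"
    by (rule integrable_kernel_continuous) (use t g in auto)
  ultimately show ?thesis
    unfolding frac_integral_def set_borel_integral_eq_integral(2)[OF *] by (subst integral_unique) auto
qed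

text \<open>
  Inserting the definition of the Caputo derivative into the fractional integral gives a double integral
  of the derivative of \<open>f\<close> over \<open>0 < s < r < t\<close>. Integrating over \<open>r\<close> first leaves the Beta integral with
  parameters \<open>1 - nu\<close> and \<open>nu\<close>, whose value does not depend on \<open>s\<close>, and the integral of the derivative
  remains. Integrability of the derivative on \<open>{0<..<t}\<close>, which is what Fubini's theorem needs, comes
  from the absolute convergence of the Caputo integral at \<open>t\<close>.
\<close>
lemma frac_integral_caputo_less_1:
  fixes f g :: "real \<Rightarrow> real"
  assumes nu: "0 < nu" "nu < 1" and t: "0 < t" and f: "continuous_on {0..t} f"
    and D: "\<And>s. 0 < s \<Longrightarrow> s \<le> t \<Longrightarrow> has_caputo_derivative f (g s) nu s"
  shows "frac_integral nu g t = f t - f 0"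
proof -
  have diff: "f differentiable (at s)" if "0 < s" "s < t" for s
    using D[OF t order_refl] nu that by (simp add: has_caputo_derivative_def)
  define k where "k s = indicator {0<..<t} s *\<^sub>R (deriv f s / (t - s) powr nu)" for s
  have k: "integrable lborel k"
    using D[OF t order_refl] nu by (simp add: has_caputo_derivative_def set_integrable_def k_def[abs_def])
  define h where "h s = indicator {0<..<t} s * deriv f s" for s
  \<comment> \<open>Dividing the Caputo integrand by its kernel, which is bounded away from 0, recovers the derivative
    of \<open>f\<close>; this gives both its measurability and its integrability.\<close>
  have h_k: "h = (\<lambda>s. k s * (t - s) powr nu)"
    by (auto simp: h_def k_def indicator_def fun_eq_iff)
  have h_meas [measurable]: "h \<in> borel_measurable borel"
    using borel_measurable_integrable[OF k] unfolding h_k by simp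
  have h_int: "integrable lborel h"
  proof (rule Bochner_Integration.integrable_bound)
    show "integrable lborel (\<lambda>s. t powr nu * k s)" using k by simp
    have "\<bar>h s\<bar> \<le> t powr nu * \<bar>k s\<bar>" for s
    proof (cases "s \<in> {0<..<t}")
      case True
      then have "(t - s) powr nu \<le> t powr nu" using nu by (intro powr_mono2) auto
      then have "\<bar>k s\<bar> * (t - s) powr nu \<le> \<bar>k s\<bar> * t powr nu" by (rule mult_left_mono) simp
      then show ?thesis by (simp add: h_k abs_mult mult.commute)
    qed (simp add: h_def)
    then show "AE s in lborel. norm (h s) \<le> norm (t powr nu * k s)"
      by (intro AE_I2) (simp add: abs_mult)
  qed simp
  have h_val: "integral\<^sup>L lborel h = f t - f 0"
  proof -
    have "(deriv f has_integral (f t - f 0)) {0..t}"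
      using t f diff by (intro fundamental_theorem_of_calculus_interior)
        (auto simp: DERIV_deriv_iff_real_differentiable simp flip: has_real_derivative_iff_has_vector_derivative)
    then have "integral {0<..<t} (deriv f) = f t - f 0"
      by (simp add: has_integral_Icc_iff_Ioo integral_unique)
    moreover have *: "set_integrable lborel {0<..<t} (deriv f)"
      using h_int by (simp add: set_integrable_def h_def[abs_def])
    ultimately show ?thesis
      using set_borel_integral_eq_integral(2)[OF *]
      by (simp add: set_lebesgue_integral_def h_def[abs_def])
  qed
  \<comment> \<open>The integrand of the double integral, extended by 0 outside \<open>0 < s < r < t\<close>.\<close>
  define F where "F s r = h s *
    (if s < r \<and> r < t then (r - s) powr (- nu) * (t - r) powr (nu - 1) else 0)" for s r
  have F_meas: "case_prod F \<in> borel_measurable (lborel \<Otimes>\<^sub>M lborel)"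
    unfolding F_def by measurable
  have inner: "has_bochner_integral lborel
      (\<lambda>r. c * (if s < r \<and> r < t then (r - s) powr (- nu) * (t - r) powr (nu - 1) else 0))
      (c * (Gamma nu * Gamma (1 - nu)))"
    if "s \<notin> {0<..<t} \<Longrightarrow> c = 0" for c s
  proof (cases "s \<in> {0<..<t}")
    case True
    have "(\<lambda>r. if s < r \<and> r < t then (r - s) powr (- nu) * (t - r) powr (nu - 1) else 0) =
        (\<lambda>r. indicator {s<..<t} r *\<^sub>R ((r - s) powr (1 - nu - 1) * (t - r) powr (nu - 1)))"
      by (auto simp: indicator_def)
    then show ?thesis
      using Beta_integral_interval[of "1 - nu" nu s t] nu True
      by (intro has_bochner_integral_mult_right)
        (simp add: has_bochner_integral_iff set_integrable_def set_lebesgue_integral_def Beta_def)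
  qed (use that in \<open>simp add: has_bochner_integral_zero\<close>)
  have inner_F: "has_bochner_integral lborel (F s) (h s * (Gamma nu * Gamma (1 - nu)))" for s
    unfolding F_def by (rule inner) (simp add: h_def)
  have inner_abs_F: "has_bochner_integral lborel (\<lambda>r. norm (F s r)) (\<bar>h s\<bar> * (Gamma nu * Gamma (1 - nu)))" for s
  proof -
    have "(\<lambda>r. norm (F s r)) = (\<lambda>r. \<bar>h s\<bar> *
        (if s < r \<and> r < t then (r - s) powr (- nu) * (t - r) powr (nu - 1) else 0))"
      unfolding F_def by (rule ext) (simp add: abs_mult)
    then show ?thesis
      by (simp only:) (rule inner, simp add: h_def)
  qed
  have "integrable (lborel \<Otimes>\<^sub>M lborel) (case_prod F)"
  proof (rule lborel_pair.Fubini_integrable[OF F_meas])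
    show "integrable lborel (\<lambda>s. LINT r|lborel. norm (case_prod F (s, r)))"
      unfolding case_prod_conv has_bochner_integral_integral_eq[OF inner_abs_F] using h_int by simp
    show "AE s in lborel. integrable lborel (\<lambda>r. case_prod F (s, r))"
      using inner_F by (intro AE_I2) (simp add: has_bochner_integral_iff)
  qed
  from lborel_pair.Fubini_integral[OF this]
  have "(LINT r|lborel. LINT s|lborel. F s r) = (LINT s|lborel. LINT r|lborel. F s r)"
    .
  also have "\<dots> = (LINT s|lborel. h s * (Gamma nu * Gamma (1 - nu)))"
    by (simp only: has_bochner_integral_integral_eq[OF inner_F])
  also have "\<dots> = (f t - f 0) * (Gamma nu * Gamma (1 - nu))"
    by (simp add: h_val)
  finally have "(LINT r|lborel. LINT s|lborel. F s r) = (f t - f 0) * (Gamma nu * Gamma (1 - nu))" .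
  moreover have "(LINT s|lborel. F s r) =
      Gamma (1 - nu) * (indicator {0<..<t} r *\<^sub>R ((t - r) powr (nu - 1) * g r))" for r
  proof (cases "r \<in> {0<..<t}")
    case True
    have "F s r = (t - r) powr (nu - 1) * (indicator {0<..<r} s *\<^sub>R (deriv f s / (r - s) powr nu))" for s
      using True by (auto simp: F_def h_def indicator_def powr_minus_divide)
    then have "(LINT s|lborel. F s r) =
        (t - r) powr (nu - 1) * (LINT s:{0<..<r}|lborel. deriv f s / (r - s) powr nu)"
      by (simp only: set_lebesgue_integral_def integral_mult_right_zero)
    also have "(LINT s:{0<..<r}|lborel. deriv f s / (r - s) powr nu) = Gamma (1 - nu) * g r"
      using D[of r] True nu by (simp add: has_caputo_derivative_def)
    finally show ?thesis using True by simp
  next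
    case False
    then have "F s r = 0" for s by (auto simp: F_def h_def indicator_def)
    then show ?thesis using False by simp
  qed
  ultimately have "Gamma (1 - nu) * (LINT s:{0<..<t}|lborel. (t - s) powr (nu - 1) * g s) =
      (f t - f 0) * (Gamma nu * Gamma (1 - nu))"
    by (simp add: set_lebesgue_integral_def)
  then show ?thesis using nu by (simp add: frac_integral_def)
qed

lemma frac_integral_caputo:
  fixes f g :: "real \<Rightarrow> real"
  assumes "0 < nu" "nu \<le> 1" "0 < t" "continuous_on {0..t} f" "continuous_on {0..t} g"
    and D: "\<And>s. 0 < s \<Longrightarrow> s \<le> t \<Longrightarrow> has_caputo_derivative f (g s) nu s"
  shows "frac_integral nu g t = f t - f 0"
proof (cases "nu = 1")
  case True
  have "(f has_real_derivative g s) (at s)" if "0 < s" "s < t" for s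
    using D[of s] that True by (simp add: has_caputo_derivative_def)
  from frac_integral_caputo_1[OF assms(3-5) this] True show ?thesis by simp
next
  case False
  with assms(2) have "nu < 1" by simp
  from frac_integral_caputo_less_1[OF assms(1) this assms(3,4) D] show ?thesis .
qed

lemma caputo_imp_continuous_on:
  assumes "0 < t" "continuous (at_right 0) f"
    and D: "\<And>s. 0 < s \<Longrightarrow> has_caputo_derivative f (g s) nu s"
  shows "continuous_on {0..t} f"
  unfolding continuous_on_eq_continuous_within
proof
  fix s assume "s \<in> {0..t}"
  show "continuous (at s within {0..t}) f"
  proof (cases "s = 0")
    case True
    with assms(1,2) show ?thesis by (simp add: at_within_Icc_at_right)
  next
    case False
    with \<open>s \<in> {0..t}\<close> have "s > 0" by simp
    have "f differentiable (at s)"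
    proof (cases "nu = 1")
      case True
      with D[OF \<open>s > 0\<close>] show ?thesis
        by (auto simp: has_caputo_derivative_def real_differentiable_def)
    next
      \<comment> \<open>The derivative at \<open>s + 1\<close> presupposes differentiability on \<open>{0<..<s + 1}\<close>, so at \<open>s\<close>.\<close>
      case False
      with D[of "s + 1"] \<open>s > 0\<close> show ?thesis
        by (simp add: has_caputo_derivative_def)
    qed
    then show ?thesis
      by (rule continuous_at_imp_continuous_at_within[OF differentiable_imp_continuous_within])
  qed
qed

section \<open>The fractional linear birth process\<close>

text \<open>
  For \<open>e j = x ^ j\<close> this is \<open>x (1 - x) ^ (k - 1)\<close>, the law of the classical Yule process at
  \<open>x = exp (- lam t)\<close>. Keeping \<open>e\<close> arbitrary separates the combinatorics from the analysis.
\<close>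
definition yule_sum :: "(nat \<Rightarrow> real) \<Rightarrow> nat \<Rightarrow> real"
  where "yule_sum e k = (\<Sum>j=1..k. real ((k - 1) choose (j - 1)) * (- 1) ^ (j - 1) * e j)"

lemma yule_sum_1:
  assumes "k \<ge> 1"
  shows "yule_sum (\<lambda>_. 1) k = (if k = 1 then 1 else 0)"
proof -
  have "yule_sum (\<lambda>_. 1) k = (\<Sum>i\<le>k - 1. (- 1) ^ i * real ((k - 1) choose i))"
    unfolding yule_sum_def
    by (rule sum.reindex_bij_witness[of _ Suc "\<lambda>j. j - 1"]) (use assms in auto)
  then show ?thesis
    using choose_alternating_sum[of "k - 1", where 'a = real] assms by (cases "k = 1") auto
qed

text \<open>
  Writing \<open>- j = - k + (k - j)\<close> and absorbing \<open>k - j\<close> into the binomial coefficient turns the weighted sum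
  into the right-hand side of the state equation.
\<close>
lemma yule_sum_weighted:
  assumes "k \<ge> 1"
  shows "yule_sum (\<lambda>j. - lam * real j * e j) k =
    - (lam * real k) * yule_sum e k + (if k = 1 then 0 else lam * real (k - 1) * yule_sum e (k - 1))"
proof (cases "k = 1")
  case True
  then show ?thesis by (simp add: yule_sum_def)
next
  case False
  \<comment> \<open>The sum may run up to \<open>k\<close> because the added coefficient \<open>(k - 2) choose (k - 1)\<close> is 0.\<close>
  have *: "yule_sum e (k - 1) = (\<Sum>j=1..k. real ((k - 2) choose (j - 1)) * (- 1) ^ (j - 1) * e j)"
    unfolding yule_sum_def using assms False
    by (intro sum.mono_neutral_cong_left) (auto simp: numeral_2_eq_2)
  have "real (k - 1) * real ((k - 2) choose (j - 1)) = (real k - real j) * real ((k - 1) choose (j - 1))"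
    if "j \<in> {1..k}" for j
  proof -
    have "k - 1 - (j - 1) = k - j" using that by auto
    then have "(k - 1) * ((k - 2) choose (j - 1)) = (k - j) * ((k - 1) choose (j - 1))"
      using binomial_absorb_comp[of "k - 1" "j - 1"] by (simp add: numeral_2_eq_2)
    then show ?thesis using that by (metis atLeastAtMost_iff of_nat_diff of_nat_mult)
  qed
  then have "lam * real (k - 1) * yule_sum e (k - 1) =
      (\<Sum>j=1..k. lam * ((real k - real j) * real ((k - 1) choose (j - 1))) * ((- 1) ^ (j - 1) * e j))"
    unfolding * sum_distrib_left by (intro sum.cong refl) (simp add: mult_ac)
  also have "\<dots> + - (lam * real k) * yule_sum e k = yule_sum (\<lambda>j. - lam * real j * e j) k"
    unfolding yule_sum_def sum_distrib_left sum.distrib[symmetric]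
    by (intro sum.cong refl) (simp add: algebra_simps)
  finally show ?thesis using False by simp
qed

lemma yule_sum_Volterra:
  fixes lam nu t :: real
  assumes nu: "0 < nu" "nu \<le> 1" and t: "0 < t" and k: "k \<ge> 1"
  defines "q \<equiv> \<lambda>k t. yule_sum (\<lambda>j. mittag_leffler nu (- lam * real j * t powr nu)) k"
  shows "q k t = (if k = 1 then 1 else 0) + frac_integral nu
    (\<lambda>s. - (lam * real k) * q k s + (if k = 1 then 0 else lam * real (k - 1) * q (k - 1) s)) t"
proof -
  define e where "e j s = mittag_leffler nu (- lam * real j * s powr nu)" for j s
  define a where "a j = real ((k - 1) choose (j - 1)) * (- 1) ^ (j - 1)" for j
  have "q k t = (\<Sum>j=1..k. a j * (1 + (- lam * real j) * frac_integral nu (e j) t))"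
    unfolding q_def yule_sum_def a_def e_def
    by (subst mittag_leffler_Volterra[OF nu t]) simp
  also have "\<dots> = yule_sum (\<lambda>_. 1) k + (\<Sum>j=1..k. frac_integral nu (\<lambda>s. a j * (- lam * real j * e j s)) t)"
    unfolding yule_sum_def a_def
    by (simp only: frac_integral_cmult distrib_left sum.distrib mult_1_right)
  also have "(\<Sum>j=1..k. frac_integral nu (\<lambda>s. a j * (- lam * real j * e j s)) t) =
      frac_integral nu (\<lambda>s. \<Sum>j=1..k. a j * (- lam * real j * e j s)) t"
    unfolding e_def using nu t
    by (intro frac_integral_sum[symmetric] continuous_on_mult continuous_on_const
        continuous_on_mittag_leffler_powr)
  also have "(\<lambda>s. \<Sum>j=1..k. a j * (- lam * real j * e j s)) = (\<lambda>s. yule_sum (\<lambda>j. - lam * real j * e j s) k)"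
    by (simp add: yule_sum_def a_def)
  finally show ?thesis
    unfolding yule_sum_1[OF k] yule_sum_weighted[OF k] unfolding q_def e_def .
qed

lemma continuous_on_yule_sum:
  assumes "0 < nu" "nu \<le> 1"
  shows "continuous_on {0..t} (\<lambda>s. yule_sum (\<lambda>j. mittag_leffler nu (- lam * real j * s powr nu)) k)"
  unfolding yule_sum_def
  by (intro continuous_intros continuous_on_mittag_leffler_powr assms)

theorem theorem3p1:
  fixes M :: "'a measure" and N :: "real \<Rightarrow> 'a \<Rightarrow> nat" and lam nu t :: real and k :: nat
  assumes "lam > 0" and "0 < nu" and "nu \<le> 1"
    and "fractional_birth_process M N (\<lambda>j. lam * real j) nu"
    and "k \<ge> 1" and "t > 0"
  shows "\<P>(\<omega> in M. N t \<omega> = k \<bar> N 0 \<omega> = 1) =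
    (\<Sum>j=1..k. real ((k - 1) choose (j - 1)) * (- 1) ^ (j - 1)
      * mittag_leffler nu (- lam * real j * t powr nu))"
proof -
  interpret fractional_birth_process M N "\<lambda>j. lam * real j" nu by fact
  define p where "p = state_prob M N"
  define q where "q k s = yule_sum (\<lambda>j. mittag_leffler nu (- lam * real j * s powr nu)) k" for k s
  define rhs where "rhs x k s = - (lam * real k) * x k s +
    (if k = 1 then 0 else lam * real (k - 1) * x (k - 1) s)" for x k and s :: real
  note nu = \<open>0 < nu\<close> \<open>nu \<le> 1\<close>
  have p_cont: "continuous_on {0..T} (p k)" if "k \<ge> 1" "T > 0" for k T
    unfolding p_def using caputo_imp_continuous_on[OF that(2) cont_at_0[OF that(1)] state_eq[OF that(1)]] .
  have q_cont: "continuous_on {0..T} (q k)" for k T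
    unfolding q_def by (rule continuous_on_yule_sum[OF nu])
  have rhs_cont: "continuous_on {0..T} (rhs x k)"
    if "k \<ge> 1" "\<And>k. k \<ge> 1 \<Longrightarrow> continuous_on {0..T} (x k)" for x k T
    unfolding rhs_def[abs_def] using that by (cases "k = 1") (auto intro!: continuous_intros)
  have p_eq: "p k t = (if k = 1 then 1 else 0) + frac_integral nu (rhs p k) t" if "k \<ge> 1" "t > 0" for k t
  proof -
    have "frac_integral nu (rhs p k) t = p k t - p k 0"
      using that state_eq[of k] nu p_cont
      by (intro frac_integral_caputo rhs_cont) (auto simp: rhs_def p_def)
    moreover have "p k 0 = (if k = 1 then 1 else 0)"
      using init_one init_other[of k] that by (auto simp: p_def)
    ultimately show ?thesis by simp
  qed
  have q_eq: "q k t = (if k = 1 then 1 else 0) + frac_integral nu (rhs q k) t" if "k \<ge> 1" "t > 0" for k t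
    unfolding q_def rhs_def using yule_sum_Volterra[OF nu that(2,1), of lam] .
  \<comment> \<open>Once \<open>p\<close> and \<open>q\<close> agree at index \<open>k - 1\<close>, the coupling terms cancel in the difference at \<open>k\<close>.\<close>
  have "p k t = q k t" if "k \<ge> 1" "t > 0" for k t
    using that
  proof (induction k arbitrary: t rule: less_induct)
    case (less k T)
    have "p k T - q k T = 0"
    proof (rule Volterra_eq_0[OF nu, where T = T and c = "- (lam * real k)"
          and u = "\<lambda>s. p k s - q k s"])
      show "continuous_on {0..T} (\<lambda>s. p k s - q k s)"
        using less.prems by (intro continuous_intros p_cont q_cont)
      fix t assume t: "0 < t" "t \<le> T"
      have "p k t - q k t = frac_integral nu (rhs p k) t - frac_integral nu (rhs q k) t"
        using p_eq q_eq less.prems t by simp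
      also have "\<dots> = frac_integral nu (\<lambda>s. rhs p k s - rhs q k s) t"
        using less.prems t nu by (intro frac_integral_diff[symmetric] rhs_cont p_cont q_cont)
      also have "\<dots> = frac_integral nu (\<lambda>s. - (lam * real k) * (p k s - q k s)) t"
        using less by (intro frac_integral_cong) (auto simp: rhs_def right_diff_distrib)
      finally show "p k t - q k t = - (lam * real k) * frac_integral nu (\<lambda>s. p k s - q k s) t"
        by (simp only: frac_integral_cmult)
    qed (use less.prems in auto)
    then show ?case by simp
  qed
  from this[OF \<open>k \<ge> 1\<close> \<open>t > 0\<close>] show ?thesis
    by (simp add: p_def q_def state_prob_def yule_sum_def)
qed

end
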